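(* Let $f:X\to X$ be the full shift on two symbols. There exist a Banach space $V$, a locally constant $GL(V)$-valued cocycle $\mathcal{A}$ over $f$, and an ergodic $f$-invariant Borel probability measure $\mu$ on $X$ such that $$\lambda(\mathcal{A},\mu)>\sup_{\mu_p}\lambda(\mathcal{A},\mu_p),$$ where the supremum is taken over all uniform probability measures $\mu_p$ on periodic orbits of $f$.
   Context: The full shift on two symbols is $X=\{\bar x=(x_n)_{n\in\mathbb{Z}}: x_n\in\{0,1\}\}$ with the product topology and $f(\bar x)=(x_{n+1})_{n\in\mathbb{Z}}$. $GL(V)$ is the group of invertible bounded linear operators on $V$, with the operator norm $\|\cdot\|$ for operators. The $GL(V)$-valued cocycle over $f$ generated by a function $A:X\to GL(V)$ is given by $\mathcal{A}_x^0=\mathrm{Id}$, $\mathcal{A}_x^n=A(f^{n-1}x)\circ\cdots\circ A(x)$ and $\mathcal{A}_x^{-n}=(\mathcal{A}_{f^{-n}x}^n)^{-1}$ for $n\in\mathbb{N}$. It is locally constant if its generator $A$ is a locally constant function on $X$. For an ergodic $f$-invariant Borel probability measure $\mu$, the upper Lyapunov exponent $\lambda(\mathcal{A},\mu)$ is the $\mu$-a.e. constant value of $\lim_{n\to\infty}\frac1n\log\|\mathcal{A}_x^n\|$ (which exists $\mu$-a.e. by the Subadditive Ergodic Theorem). For a periodic point $p$, $\mu_p$ denotes the uniform probability measure on the orbit of $p$. *)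

theory Defs
  imports "HOL-Probability.Probability" "HOL-Algebra.Module"
begin

section \<open>Banach spaces with an explicit carrier\<close>

text \<open>
  The class \<open>banach\<close> cannot be used below an existential quantifier, since HOL does not
  quantify over types.  A Banach space is therefore a structure: a module over the
  field of real numbers in the sense of HOL-Algebra, together with a norm.
  The fields \<open>mult\<close> and \<open>one\<close>, which the record type of modules inherits from rings,
  are not used.
\<close>

definition real_field :: "real ring" where
  "real_field = \<lparr>carrier = UNIV, mult = (*), one = 1, zero = 0, add = (+)\<rparr>"

record 'v normed_space = "(real, 'v) module" +
  vnorm :: "'v \<Rightarrow> real" ("\<nu>\<index>")

text \<open>
  The value 0 off the carrier only serves to make the distance symmetric and
  nonnegative on the whole type, as the locale \<open>Metric_space\<close> demands.
\<close>

definition vdist :: "('v, 'm) normed_space_scheme \<Rightarrow> 'v \<Rightarrow> 'v \<Rightarrow> real" where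
  "vdist V x y =
     (if x \<in> carrier V \<and> y \<in> carrier V then \<nu>\<^bsub>V\<^esub> (x \<ominus>\<^bsub>V\<^esub> y) else 0)"

locale banach_space = Module.module real_field V
  for V :: "('v, 'm) normed_space_scheme" (structure) +
  assumes norm_nonneg: "x \<in> carrier V \<Longrightarrow> 0 \<le> \<nu> x"
    and norm_eq_zero_iff: "x \<in> carrier V \<Longrightarrow> \<nu> x = 0 \<longleftrightarrow> x = \<zero>"
    and norm_smult: "x \<in> carrier V \<Longrightarrow> \<nu> (a \<odot> x) = \<bar>a\<bar> * \<nu> x"
    and norm_triangle:
      "x \<in> carrier V \<Longrightarrow> y \<in> carrier V \<Longrightarrow> \<nu> (x \<oplus> y) \<le> \<nu> x + \<nu> y"
    and complete: "Metric_space.mcomplete (carrier V) (vdist V)"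

section \<open>Bounded operators and the general linear group\<close>

text \<open>
  Operators are extensional functions, so that two operators on \<open>V\<close> are equal
  as soon as they agree on the carrier.
\<close>

definition bounded_operators :: "('v, 'm) normed_space_scheme \<Rightarrow> ('v \<Rightarrow> 'v) set" where
  "bounded_operators V =
     {T \<in> carrier V \<rightarrow>\<^sub>E carrier V.
        (\<forall>u\<in>carrier V. \<forall>v\<in>carrier V. T (u \<oplus>\<^bsub>V\<^esub> v) = T u \<oplus>\<^bsub>V\<^esub> T v) \<and>
        (\<forall>a. \<forall>v\<in>carrier V. T (a \<odot>\<^bsub>V\<^esub> v) = a \<odot>\<^bsub>V\<^esub> T v) \<and>
        (\<exists>C. \<forall>v\<in>carrier V. \<nu>\<^bsub>V\<^esub> (T v) \<le> C * \<nu>\<^bsub>V\<^esub> v)}"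

definition operator_monoid :: "('v, 'm) normed_space_scheme \<Rightarrow> ('v \<Rightarrow> 'v) monoid" where
  "operator_monoid V =
     \<lparr>carrier = bounded_operators V,
      mult = compose (carrier V),
      one = (\<lambda>v\<in>carrier V. v)\<rparr>"

definition GL :: "('v, 'm) normed_space_scheme \<Rightarrow> ('v \<Rightarrow> 'v) monoid" where
  "GL V = units_of (operator_monoid V)"

definition op_norm :: "('v, 'm) normed_space_scheme \<Rightarrow> ('v \<Rightarrow> 'v) \<Rightarrow> real" where
  "op_norm V T = (SUP v\<in>{v \<in> carrier V. \<nu>\<^bsub>V\<^esub> v \<le> 1}. \<nu>\<^bsub>V\<^esub> (T v))"

section \<open>The full shift on two symbols\<close>

text \<open>
  The symbols 0 and 1 are \<open>False\<close> and \<open>True\<close>; the topology on \<open>full_shift\<close> is the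
  product of the discrete topologies, by the type class instances for functions
  and for \<open>bool\<close>.
\<close>

type_synonym full_shift = "int \<Rightarrow> bool"

definition shift :: "full_shift \<Rightarrow> full_shift" where
  "shift x = (\<lambda>n. x (n + 1))"

definition ergodic_invariant_prob :: "full_shift measure \<Rightarrow> bool" where
  "ergodic_invariant_prob \<mu> \<longleftrightarrow>
     prob_space \<mu> \<and> sets \<mu> = sets borel \<and>
     distr \<mu> borel shift = \<mu> \<and>
     (\<forall>B\<in>sets borel. shift -` B = B \<longrightarrow> measure \<mu> B = 0 \<or> measure \<mu> B = 1)"

definition periodic_point :: "full_shift \<Rightarrow> bool" where
  "periodic_point p \<longleftrightarrow> (\<exists>n>0. (shift ^^ n) p = p)"

definition orbit_measure :: "full_shift \<Rightarrow> full_shift measure" where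
  "orbit_measure p =
     distr (uniform_count_measure (range (\<lambda>n. (shift ^^ n) p))) borel (\<lambda>x. x)"

section \<open>Cocycles over the shift and their upper Lyapunov exponents\<close>

definition locally_constant :: "(full_shift \<Rightarrow> 'b) \<Rightarrow> bool" where
  "locally_constant A \<longleftrightarrow> (\<forall>x. \<exists>U. open U \<and> x \<in> U \<and> A constant_on U)"

primrec forward_cocycle ::
  "('v, 'm) normed_space_scheme \<Rightarrow> (full_shift \<Rightarrow> 'v \<Rightarrow> 'v) \<Rightarrow> full_shift \<Rightarrow> nat \<Rightarrow> 'v \<Rightarrow> 'v"
where
  "forward_cocycle V A x 0 = \<one>\<^bsub>GL V\<^esub>"
| "forward_cocycle V A x (Suc n) = A ((shift ^^ n) x) \<otimes>\<^bsub>GL V\<^esub> forward_cocycle V A x n"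

definition cocycle ::
  "('v, 'm) normed_space_scheme \<Rightarrow> (full_shift \<Rightarrow> 'v \<Rightarrow> 'v) \<Rightarrow> full_shift \<Rightarrow> int \<Rightarrow> 'v \<Rightarrow> 'v"
where
  "cocycle V A x n =
     (if 0 \<le> n then forward_cocycle V A x (nat n)
      else inv\<^bsub>GL V\<^esub>
        (forward_cocycle V A ((inv_into UNIV shift ^^ nat (- n)) x) (nat (- n))))"

text \<open>
  Extended reals make the supremum of a family of exponents meaningful without a
  boundedness proof.  Since \<open>ln 0 = 0\<close>, every exponent on the zero space is 0
  rather than \<open>-\<infinity>\<close>; on any other space an operator in \<open>GL V\<close> has positive norm.
\<close>

definition lyapunov_exponent ::
  "('v, 'm) normed_space_scheme \<Rightarrow> (full_shift \<Rightarrow> 'v \<Rightarrow> 'v) \<Rightarrow> full_shift measure \<Rightarrow> ereal"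
where
  "lyapunov_exponent V A \<mu> =
     (THE l. AE x in \<mu>.
        (\<lambda>n. ereal (1 / real n * ln (op_norm V (cocycle V A x (int n))))) \<longlonglongrightarrow> l)"

end

theory Submission
  imports Defs
begin

text \<open>Let \<open>\<mu>\<close> be the measure carried by the period-doubling Toeplitz sequences, the image of Haar
  measure on the 2-adic integers, and let \<open>L\<close> be its set of words. No periodic sequence of
  period \<open>m\<close> has a factor of length \<open>5 m\<close> in \<open>L\<close>. Prepending letters to words extends to two
  permutations of a countable set, and \<open>V\<close> is the space of functions on that set bounded by a
  multiple of \<open>2 ^ h\<close>, where the height \<open>h\<close> of a word counts its nonempty suffixes that lie in
  \<open>L\<close>. The operators \<open>A x\<close> are compositions with the permutations, so the norm of a product is
  the largest value of \<open>2\<close> to the increase of height: it is \<open>2 ^ n\<close> along Toeplitz sequences and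
  stays between \<open>1\<close> and \<open>2 ^ (5 m)\<close> along sequences of period \<open>m\<close>. The exponents are \<open>ln 2\<close>
  and \<open>0\<close>.\<close>

section \<open>Weighted sequence spaces\<close>

text \<open>For positive \<open>W\<close>, the vector \<open>W\<close> itself has norm 1, and
  composition with \<open>g\<close> has operator norm the supremum of \<open>W (g s) / W s\<close>,
  when that is finite.\<close>

definition weighted_linf :: "('i \<Rightarrow> real) \<Rightarrow> ('i \<Rightarrow> real) normed_space" where
  "weighted_linf W =
     \<lparr>carrier = {v. bdd_above (range (\<lambda>s. \<bar>v s\<bar> / W s))},
      mult = undefined, one = undefined,
      zero = (\<lambda>_. 0), add = (\<lambda>u v s. u s + v s),
      smult = (\<lambda>a v s. a * v s),
      vnorm = (\<lambda>v. SUP s. \<bar>v s\<bar> / W s)\<rparr>"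

text \<open>The restriction to the carrier makes the operator extensional, as
  \<open>bounded_operators\<close> demands.\<close>

definition pull :: "('i \<Rightarrow> real) \<Rightarrow> ('i \<Rightarrow> 'i) \<Rightarrow> ('i \<Rightarrow> real) \<Rightarrow> 'i \<Rightarrow> real" where
  "pull W g = (\<lambda>v\<in>carrier (weighted_linf W). v \<circ> g)"

lemma cring_real_field: "cring real_field"
proof (rule cringI)
  show "abelian_group real_field"
  proof (rule abelian_groupI)
    fix x assume "x \<in> carrier real_field"
    show "\<exists>y\<in>carrier real_field. y \<oplus>\<^bsub>real_field\<^esub> x = \<zero>\<^bsub>real_field\<^esub>"
      by (rule bexI[of _ "- x"]) (auto simp: real_field_def)
  qed (auto simp: real_field_def)
  show "comm_monoid real_field"
    by (rule comm_monoidI) (auto simp: real_field_def)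
qed (auto simp: real_field_def algebra_simps)

locale weighted_space =
  fixes W :: "'i \<Rightarrow> real"
  assumes W_pos: "\<And>s. 0 < W s"
begin

abbreviation "VW \<equiv> weighted_linf W"

lemma ops [simp]:
  "\<zero>\<^bsub>VW\<^esub> = (\<lambda>_. 0)" "u \<oplus>\<^bsub>VW\<^esub> v = (\<lambda>s. u s + v s)" "a \<odot>\<^bsub>VW\<^esub> v = (\<lambda>s. a * v s)"
  by (auto simp: weighted_linf_def)

lemma carrier_iff: "v \<in> carrier VW \<longleftrightarrow> (\<exists>C. \<forall>s. \<bar>v s\<bar> \<le> C * W s)"
  using W_pos by (auto simp: weighted_linf_def bdd_above_def pos_divide_le_eq)

lemma abs_le_norm: "v \<in> carrier VW \<Longrightarrow> \<bar>v s\<bar> \<le> \<nu>\<^bsub>VW\<^esub> v * W s"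
  using W_pos[of s] cSUP_upper[of s UNIV "\<lambda>s. \<bar>v s\<bar> / W s"]
  by (auto simp: weighted_linf_def pos_divide_le_eq)

lemma norm_le: "(\<And>s. \<bar>v s\<bar> \<le> C * W s) \<Longrightarrow> \<nu>\<^bsub>VW\<^esub> v \<le> C"
  using W_pos by (auto simp: weighted_linf_def pos_divide_le_eq intro!: cSUP_least)

lemma weighted_norm_nonneg: 
  assumes "v \<in> carrier VW" shows "0 \<le> \<nu>\<^bsub>VW\<^esub> v"
proof -
  \<comment> \<open>Any index would do to cancel a positive weight; \<open>undefined\<close> names
    one.\<close>
  have "0 \<le> \<nu>\<^bsub>VW\<^esub> v * W undefined"
    using abs_le_norm[OF assms, of undefined] by linarith
  then show ?thesis
    using W_pos[of undefined] by (simp add: zero_le_mult_iff)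
qed

lemma zero_carrier: "(\<lambda>_. 0) \<in> carrier VW"
  by (auto simp: carrier_iff intro: exI[of _ 0])

lemma add_bound:
  assumes "\<And>s. \<bar>u s\<bar> \<le> C * W s" "\<And>s. \<bar>v s\<bar> \<le> D * W s"
  shows "\<bar>u s + v s\<bar> \<le> (C + D) * W s"
  using assms[of s] by (simp add: algebra_simps)

lemma smult_bound:
  assumes "\<And>s. \<bar>u s\<bar> \<le> C * W s"
  shows "\<bar>a * u s\<bar> \<le> (\<bar>a\<bar> * C) * W s"
  using assms[of s] by (simp add: abs_mult mult.assoc mult_left_mono)

lemma add_carrier: "u \<in> carrier VW \<Longrightarrow> v \<in> carrier VW \<Longrightarrow> (\<lambda>s. u s + v s) \<in> carrier VW"
  unfolding carrier_iff using add_bound by metis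

lemma smult_carrier: "u \<in> carrier VW \<Longrightarrow> (\<lambda>s. a * u s) \<in> carrier VW"
  unfolding carrier_iff using smult_bound by metis

lemma abelian_group_weighted: "abelian_group VW"
proof (rule abelian_groupI)
  fix x assume "x \<in> carrier VW"
  then show "\<exists>y\<in>carrier VW. y \<oplus>\<^bsub>VW\<^esub> x = \<zero>\<^bsub>VW\<^esub>"
    using smult_carrier[of x "-1"] by (intro bexI[of _ "\<lambda>s. - 1 * x s"]) auto
qed (auto simp: zero_carrier add_carrier algebra_simps)

lemma minus_weighted:
  assumes "u \<in> carrier VW" "v \<in> carrier VW"
  shows "u \<ominus>\<^bsub>VW\<^esub> v = (\<lambda>s. u s - v s)"
proof -
  interpret abelian_group VW by (rule abelian_group_weighted)
  have "(\<lambda>s. - 1 * v s) \<in> carrier VW"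
    using assms by (intro smult_carrier)
  then have "\<ominus>\<^bsub>VW\<^esub> v = (\<lambda>s. - 1 * v s)"
    using assms by (intro minus_equality) auto
  then show ?thesis
    by (simp add: a_minus_def)
qed

lemma norm_smult_le:
  assumes "v \<in> carrier VW"
  shows "\<nu>\<^bsub>VW\<^esub> (\<lambda>s. a * v s) \<le> \<bar>a\<bar> * \<nu>\<^bsub>VW\<^esub> v"
  using abs_le_norm[OF assms] by (intro norm_le smult_bound)

text \<open>The inequality missing from \<open>norm_smult_le\<close> is that lemma applied to the
  inverse scalar.\<close>

lemma norm_smult_weighted:
  assumes v: "v \<in> carrier VW"
  shows "\<nu>\<^bsub>VW\<^esub> (\<lambda>s. a * v s) = \<bar>a\<bar> * \<nu>\<^bsub>VW\<^esub> v"
proof (cases "a = 0")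
  case True
  have "\<nu>\<^bsub>VW\<^esub> (\<lambda>_. 0) \<le> 0" by (rule norm_le) simp
  with True show ?thesis
    using weighted_norm_nonneg[OF zero_carrier] by simp
next
  case False
  then have "\<nu>\<^bsub>VW\<^esub> v \<le> \<bar>inverse a\<bar> * \<nu>\<^bsub>VW\<^esub> (\<lambda>s. a * v s)"
    using norm_smult_le[OF smult_carrier[OF v, of a], of "inverse a"]
    by (simp add: mult.assoc[symmetric])
  then have "\<bar>a\<bar> * \<nu>\<^bsub>VW\<^esub> v \<le> \<nu>\<^bsub>VW\<^esub> (\<lambda>s. a * v s)"
    using False by (simp add: field_simps)
  with norm_smult_le[OF v, of a] show ?thesis by simp
qed

lemma norm_triangle_weighted:
  assumes "u \<in> carrier VW" "v \<in> carrier VW"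
  shows "\<nu>\<^bsub>VW\<^esub> (\<lambda>s. u s + v s) \<le> \<nu>\<^bsub>VW\<^esub> u + \<nu>\<^bsub>VW\<^esub> v"
  using assms by (intro norm_le add_bound abs_le_norm)

lemma norm_eq_zero_weighted:
  assumes "v \<in> carrier VW"
  shows "\<nu>\<^bsub>VW\<^esub> v = 0 \<longleftrightarrow> v = (\<lambda>_. 0)"
proof
  assume "\<nu>\<^bsub>VW\<^esub> v = 0"
  then show "v = (\<lambda>_. 0)" using abs_le_norm[OF assms] by auto
next
  assume "v = (\<lambda>_. 0)"
  then show "\<nu>\<^bsub>VW\<^esub> v = 0"
    using norm_smult_weighted[OF zero_carrier, of 0] by simp
qed

lemma diff_carrier:
  "u \<in> carrier VW \<Longrightarrow> v \<in> carrier VW \<Longrightarrow> (\<lambda>s. u s - v s) \<in> carrier VW"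
  using add_carrier[of u "\<lambda>s. -1 * v s"] smult_carrier[of v "-1"] by simp

lemma vdist_weighted:
  assumes "u \<in> carrier VW" "v \<in> carrier VW"
  shows "vdist VW u v = \<nu>\<^bsub>VW\<^esub> (\<lambda>s. u s - v s)"
  using assms by (simp add: vdist_def minus_weighted)

lemma metric_space_weighted: "Metric_space (carrier VW) (vdist VW)"
proof
  have *: "\<nu>\<^bsub>VW\<^esub> (\<lambda>s. y s - x s) = \<nu>\<^bsub>VW\<^esub> (\<lambda>s. x s - y s)" if "x \<in> carrier VW" "y \<in> carrier VW" for x y
    using norm_smult_weighted[OF diff_carrier[OF that], of "-1"] by simp
  show "0 \<le> vdist VW x y" for x y
    by (cases "x \<in> carrier VW \<and> y \<in> carrier VW")
      (auto simp: vdist_weighted weighted_norm_nonneg diff_carrier, auto simp: vdist_def)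
  show "vdist VW x y = vdist VW y x" for x y
    by (cases "x \<in> carrier VW \<and> y \<in> carrier VW")
      (auto simp: vdist_weighted intro: *, auto simp: vdist_def)
  show "(vdist VW x y = 0) = (x = y)" if "x \<in> carrier VW" "y \<in> carrier VW" for x y
    using that by (auto simp: vdist_weighted norm_eq_zero_weighted diff_carrier fun_eq_iff)
  show "vdist VW x z \<le> vdist VW x y + vdist VW y z"
    if "x \<in> carrier VW" "y \<in> carrier VW" "z \<in> carrier VW" for x y z
    using that norm_triangle_weighted[OF diff_carrier[of x y] diff_carrier[of y z]]
    by (simp add: vdist_weighted)
qed

text \<open>A Cauchy sequence converges at each index. Letting one of the two indices tend to
  infinity in the Cauchy estimate makes this convergence uniform relative to \<open>W\<close>, which
  also puts the limit into the carrier.\<close>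

lemma mcomplete_weighted: "Metric_space.mcomplete (carrier VW) (vdist VW)"
proof -
  interpret Metric_space "carrier VW" "vdist VW" by (rule metric_space_weighted)
  show ?thesis
    unfolding mcomplete_def
  proof (intro allI impI)
    fix u assume "MCauchy u"
    then have u: "\<And>n. u n \<in> carrier VW"
      and cau: "\<And>e. e > 0 \<Longrightarrow> \<exists>N. \<forall>n m. N \<le> n \<longrightarrow> N \<le> m \<longrightarrow> vdist VW (u n) (u m) < e"
      by (auto simp: MCauchy_def)
    have pt: "\<bar>u n s - u m s\<bar> \<le> vdist VW (u n) (u m) * W s" for n m s
      using abs_le_norm[OF diff_carrier[OF u u]] by (simp add: vdist_weighted u)
    have "Cauchy (\<lambda>n. u n s)" for s
    proof (rule metric_CauchyI)
      fix e :: real assume "e > 0"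
      then have "e / W s > 0" using W_pos by simp
      from cau[OF this] obtain N
        where N: "\<And>n m. N \<le> n \<Longrightarrow> N \<le> m \<Longrightarrow> vdist VW (u n) (u m) < e / W s" by blast
      have "dist (u n s) (u m s) < e" if "n \<ge> N" "m \<ge> N" for n m
        using pt[of n s m] N[OF that] W_pos[of s]
        by (simp add: dist_real_def pos_less_divide_eq)
      then show "\<exists>N. \<forall>m\<ge>N. \<forall>n\<ge>N. dist (u m s) (u n s) < e" by blast
    qed
    then obtain v where v: "\<And>s. (\<lambda>n. u n s) \<longlonglongrightarrow> v s"
      unfolding Cauchy_convergent_iff convergent_def by metis
    have close: "\<exists>N. \<forall>n\<ge>N. \<forall>s. \<bar>u n s - v s\<bar> \<le> e * W s" if "e > 0" for e
    proof -
      from cau[OF that] obtain N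
        where N: "\<And>n m. N \<le> n \<Longrightarrow> N \<le> m \<Longrightarrow> vdist VW (u n) (u m) < e" by blast
      have "\<bar>u n s - v s\<bar> \<le> e * W s" if n: "n \<ge> N" for n s
      proof (rule tendsto_upperbound)
        show "(\<lambda>m. \<bar>u n s - u m s\<bar>) \<longlonglongrightarrow> \<bar>u n s - v s\<bar>"
          by (intro tendsto_intros v)
        have "\<bar>u n s - u m s\<bar> \<le> e * W s" if "m \<ge> N" for m
          using pt[of n s m] mult_right_mono[OF less_imp_le[OF N[OF n that]], of "W s"] W_pos[of s]
          by linarith
        then show "\<forall>\<^sub>F m in sequentially. \<bar>u n s - u m s\<bar> \<le> e * W s"
          by (auto simp: eventually_sequentially)
      qed simp
      then show ?thesis by blast
    qed
    from close[of 1] obtain N where N: "\<And>s. \<bar>u N s - v s\<bar> \<le> 1 * W s" by auto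
    then have "(\<lambda>s. u N s - v s) \<in> carrier VW" unfolding carrier_iff by blast
    from diff_carrier[OF u[of N] this] have vc: "v \<in> carrier VW" by simp
    have "\<exists>N. \<forall>n\<ge>N. u n \<in> carrier VW \<and> vdist VW (u n) v < e" if "e > 0" for e
    proof -
      \<comment> \<open>Half of \<open>e\<close>, because \<open>norm_le\<close> yields only a weak
        inequality.\<close>
      from close[of "e / 2"] that obtain N
        where "\<And>n s. n \<ge> N \<Longrightarrow> \<bar>u n s - v s\<bar> \<le> e / 2 * W s" by auto
      then have "vdist VW (u n) v \<le> e / 2" if "n \<ge> N" for n
        using that by (simp only: vdist_weighted u vc) (rule norm_le)
      moreover have "e / 2 < e" using that by simp
      ultimately show ?thesis using u by (intro exI[of _ N]) (blast intro: le_less_trans)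
    qed
    with vc show "\<exists>x. limitin mtopology u x sequentially"
      by (auto simp: limit_metric_sequentially)
  qed
qed

lemma banach_space_weighted: "banach_space VW"
proof -
  have "Module.module real_field VW"
    by (rule Module.moduleI)
      (auto simp: cring_real_field abelian_group_weighted smult_carrier,
       auto simp: real_field_def algebra_simps)
  then show ?thesis
    by (rule banach_space.intro)
      (unfold_locales, auto simp: weighted_norm_nonneg norm_eq_zero_weighted
        norm_smult_weighted norm_triangle_weighted mcomplete_weighted)
qed

section \<open>Composition operators on the weighted space\<close>

lemma weight_in_unit_ball: "W \<in> carrier VW" "\<nu>\<^bsub>VW\<^esub> W \<le> 1"
  using W_pos by (auto simp: carrier_iff less_imp_le intro!: exI[of _ 1] norm_le)

lemma comp_bound:
  assumes g: "\<And>s. W (g s) \<le> D * W s" and v: "v \<in> carrier VW"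
  shows "\<bar>v (g s)\<bar> \<le> (D * \<nu>\<^bsub>VW\<^esub> v) * W s"
proof -
  have "\<bar>v (g s)\<bar> \<le> \<nu>\<^bsub>VW\<^esub> v * W (g s)" by (rule abs_le_norm[OF v])
  also have "\<dots> \<le> \<nu>\<^bsub>VW\<^esub> v * (D * W s)"
    using g weighted_norm_nonneg[OF v] by (rule mult_left_mono)
  finally show ?thesis by (simp add: mult_ac)
qed

lemma comp_carrier:
  "(\<And>s. W (g s) \<le> D * W s) \<Longrightarrow> v \<in> carrier VW \<Longrightarrow> v \<circ> g \<in> carrier VW"
  unfolding carrier_iff[of "v \<circ> g"] using comp_bound by fastforce

lemma pull_bounded:
  assumes "\<And>s. W (g s) \<le> D * W s"
  shows "pull W g \<in> bounded_operators VW"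
proof -
  have "\<nu>\<^bsub>VW\<^esub> (v \<circ> g) \<le> D * \<nu>\<^bsub>VW\<^esub> v" if "v \<in> carrier VW" for v
    using comp_bound[OF assms that] by (auto intro: norm_le)
  then show ?thesis
    using comp_carrier[OF assms]
    by (auto simp: bounded_operators_def pull_def add_carrier smult_carrier fun_eq_iff)
qed

lemma pull_compose:
  assumes "\<And>s. W (g s) \<le> D * W s"
  shows "compose (carrier VW) (pull W h) (pull W g) = pull W (g \<circ> h)"
  using comp_carrier[OF assms] by (auto simp: compose_def pull_def fun_eq_iff restrict_def)

text \<open>The inverse operator is composition with the inverse map, so both maps must raise the
  weight by at most a constant factor.\<close>

lemma pull_in_GL:
  assumes "\<And>s. W (g s) \<le> D * W s" "\<And>s. W (h s) \<le> E * W s" "g \<circ> h = id" "h \<circ> g = id"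
  shows "pull W g \<in> carrier (GL VW)"
proof -
  have "compose (carrier VW) (pull W h) (pull W g) = (\<lambda>v\<in>carrier VW. v)"
    "compose (carrier VW) (pull W g) (pull W h) = (\<lambda>v\<in>carrier VW. v)"
    using pull_compose[OF assms(1), of h] pull_compose[OF assms(2), of g] assms(3,4)
    by (auto simp: pull_def)
  then show ?thesis
    using pull_bounded[OF assms(1)] pull_bounded[OF assms(2)]
    by (auto simp: GL_def units_of_def Units_def operator_monoid_def)
qed

lemma norm_pull_le:
  assumes g: "\<And>s. W (g s) \<le> D * W s" and v: "v \<in> carrier VW" "\<nu>\<^bsub>VW\<^esub> v \<le> 1"
  shows "\<nu>\<^bsub>VW\<^esub> (pull W g v) \<le> D"
proof -
  have "0 < D * W undefined" using W_pos[of "g undefined"] g[of undefined] by linarith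
  then have "0 \<le> D" using W_pos[of undefined] by (simp add: zero_less_mult_iff)
  have "\<nu>\<^bsub>VW\<^esub> (v \<circ> g) \<le> D * \<nu>\<^bsub>VW\<^esub> v"
    using comp_bound[OF g v(1)] by (auto intro: norm_le)
  also have "\<dots> \<le> D * 1" using v(2) \<open>0 \<le> D\<close> by (rule mult_left_mono)
  finally show ?thesis using v(1) by (simp add: pull_def)
qed

lemma op_norm_pull_le:
  assumes "\<And>s. W (g s) \<le> D * W s"
  shows "op_norm VW (pull W g) \<le> D"
  unfolding op_norm_def
  by (rule cSUP_least) (use weight_in_unit_ball norm_pull_le[OF assms] in auto)

text \<open>The weight itself is the extremal vector of the unit ball.\<close>

lemma op_norm_pull_ge:
  assumes "\<And>s. W (g s) \<le> D * W s"
  shows "W (g s) \<le> op_norm VW (pull W g) * W s"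
proof -
  have "\<nu>\<^bsub>VW\<^esub> (pull W g W) \<le> op_norm VW (pull W g)"
    unfolding op_norm_def
    by (rule cSUP_upper)
      (use weight_in_unit_ball norm_pull_le[OF assms] in \<open>auto intro!: bdd_aboveI[of _ D]\<close>)
  then have "\<nu>\<^bsub>VW\<^esub> (W \<circ> g) * W s \<le> op_norm VW (pull W g) * W s"
    using weight_in_unit_ball W_pos[of s] by (intro mult_right_mono) (auto simp: pull_def)
  moreover have "\<bar>(W \<circ> g) s\<bar> \<le> \<nu>\<^bsub>VW\<^esub> (W \<circ> g) * W s"
    using comp_carrier[OF assms weight_in_unit_ball(1)] by (rule abs_le_norm)
  ultimately show ?thesis by simp
qed

end

section \<open>Two permutations of a countable set\<close>

type_synonym vertex = "bool list \<times> int"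

definition dir :: "bool \<Rightarrow> int" where
  "dir a = (if a then 1 else -1)"

text \<open>Prefixing a letter is injective but not surjective on words, so each word \<open>w\<close>, sitting at
  \<open>(w, 0)\<close>, gets two rays \<open>(w, k)\<close>: letter \<open>True\<close> moves inwards on the ray \<open>k > 0\<close>, letter
  \<open>False\<close> on the ray \<open>k < 0\<close>. If \<open>w\<close> begins with the letter of a ray, that ray is not needed
  and consists of fixed points.\<close>

definition push :: "bool \<Rightarrow> vertex \<Rightarrow> vertex" where
  "push a = (\<lambda>(w, k).
     if k = 0 then (a # w, 0)
     else if (0 < k \<longleftrightarrow> a) \<and> \<not> (\<exists>v. w = a # v) then (w, k - dir a)
     else (w, k))"

definition pop :: "bool \<Rightarrow> vertex \<Rightarrow> vertex" where
  "pop a = (\<lambda>(w, k).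
     if k = 0 then (if \<exists>v. w = a # v then (tl w, 0) else (w, dir a))
     else if (0 < k \<longleftrightarrow> a) \<and> \<not> (\<exists>v. w = a # v) then (w, k + dir a)
     else (w, k))"

lemma pop_push: "pop a (push a s) = s"
  by (cases s) (auto simp: push_def pop_def dir_def)

text \<open>Surjectivity of \<open>push a\<close>: a vertex \<open>(w, 0)\<close> whose word does
  not begin with \<open>a\<close> is reached from \<open>(w, dir a)\<close>, the innermost point of
  its ray.\<close>

lemma push_pop: "push a (pop a s) = s"
  by (cases s) (auto simp: push_def pop_def dir_def)

section \<open>Height and its growth under pushes\<close>

fun gain :: "bool list set \<Rightarrow> bool list \<Rightarrow> nat" where
  "gain L [] = 0"
| "gain L (a # w) = gain L w + (if a # w \<in> L then 1 else 0)"

text \<open>The ray coordinate is ignored, so moving along a ray leaves the height unchanged and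
  only prepending a letter can raise it.\<close>

definition height :: "bool list set \<Rightarrow> vertex \<Rightarrow> nat" where
  "height L s = gain L (fst s)"

lemma height_push: "height L s \<le> height L (push a s)" "height L (push a s) \<le> height L s + 1"
  by (cases s, auto simp: height_def push_def)+

text \<open>The letter of largest index is pushed first, so that the result spells
  \<open>x 0, ..., x (n - 1)\<close> from left to right.\<close>

primrec push_word :: "(nat \<Rightarrow> bool) \<Rightarrow> nat \<Rightarrow> vertex \<Rightarrow> vertex" where
  "push_word x 0 = id"
| "push_word x (Suc n) = push_word x n \<circ> push (x n)"

lemma height_push_word:
  "height L s \<le> height L (push_word x n s) \<and> height L (push_word x n s) \<le> height L s + n"
proof (induction n arbitrary: s)
  case (Suc n)
  have eq: "push_word x (Suc n) s = push_word x n (push (x n) s)" by simp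
  show ?case
    unfolding eq using Suc[of "push (x n) s"] height_push(1)[of L s "x n"] height_push(2)[of L "x n" s]
    by (intro conjI) linarith+
qed simp

lemma push_word_base: "push_word x n (w, 0) = (map x [0..<n] @ w, 0)"
  by (induction n arbitrary: w) (auto simp: push_def)

text \<open>The walk starts on a ray or at its base. If it never reaches the base, the word stays
  \<open>w\<close>; if it is at the base with \<open>m\<close> letters left, these are
  \<open>x 0, ..., x (m - 1)\<close>.\<close>

lemma height_push_word_cases:
  "height L (push_word x n (w, k)) = gain L w \<or>
   (\<exists>m\<le>n. height L (push_word x n (w, k)) = gain L (map x [0..<m] @ w))"
proof (induction n arbitrary: k)
  case 0
  then show ?case by (auto simp: height_def)
next
  case (Suc n)
  show ?case
  proof (cases "k = 0")
    case True
    then show ?thesis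
      using push_word_base[of x "Suc n" w]
      by (auto simp: height_def simp del: push_word.simps)
  next
    case False
    then have "push (x n) (w, k) = (w, snd (push (x n) (w, k)))"
      by (simp add: push_def)
    then obtain k' where "push (x n) (w, k) = (w, k')" by blast
    then show ?thesis using Suc[of k'] by (auto intro: le_SucI)
  qed
qed

text \<open>A suffix containing at least \<open>N\<close> of the new letters begins with a factor of
  \<open>x\<close> of length \<open>N\<close>, hence is outside \<open>L\<close>. Only shorter
  extensions of \<open>w\<close> can add to the gain.\<close>

lemma gain_append_le:
  assumes "\<And>i v. map x [i..<i+N] @ v \<notin> L"
  shows "gain L (map x [i..<i+l] @ w) \<le> gain L w + min l N"
proof (induction l arbitrary: i)
  case (Suc l)
  have eq: "map x [i..<i + Suc l] @ w = x i # (map x [Suc i..<Suc i + l] @ w)"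
    by (simp add: upt_conv_Cons del: upt_Suc)
  show ?case
  proof (cases "N \<le> Suc l")
    case True
    then obtain r where "Suc l = N + r" using le_Suc_ex by blast
    then have "map x [i..<i + Suc l] @ w = map x [i..<i+N] @ (map x [i+N..<i+N+r] @ w)"
      using upt_add_eq_append[of i "i + N" r] by (simp add: add.assoc del: upt_Suc)
    then have "map x [i..<i + Suc l] @ w \<notin> L" using assms by simp
    then show ?thesis using Suc[of "Suc i"] unfolding eq by simp
  next
    case False
    then show ?thesis using Suc[of "Suc i"] unfolding eq by simp
  qed
qed simp

lemma height_push_word_bounded:
  assumes "\<And>i v. map x [i..<i+N] @ v \<notin> L"
  shows "height L (push_word x n s) \<le> height L s + N"
proof (cases s)
  case (Pair w k)
  have "gain L (map x [0..<m] @ w) \<le> gain L w + N" for m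
    using gain_append_le[OF assms, of 0 m w] by simp
  with height_push_word_cases[of L x n w k] show ?thesis
    by (auto simp: Pair height_def)
qed

lemma height_push_word_full:
  assumes "\<And>i. i < n \<Longrightarrow> map x [i..<n] \<in> L"
  shows "height L (push_word x n ([], 0)) = n"
proof -
  \<comment> \<open>The induction starts at the right end of the word because \<open>gain\<close>
    counts suffixes.\<close>
  have "j \<le> n \<Longrightarrow> gain L (map x [n - j..<n]) = j" for j
  proof (induction j)
    case (Suc j)
    then have "[n - Suc j..<n] = (n - Suc j) # [n - j..<n]"
      by (simp add: upt_conv_Cons Suc_diff_Suc)
    then show ?case
      using Suc assms[of "n - Suc j"] by simp
  qed simp
  from this[of n] show ?thesis by (simp add: push_word_base height_def)
qed

section \<open>The odometer\<close>

text \<open>A sequence of bits is read as a 2-adic integer, with residue \<open>res w k\<close> modulo \<open>2 ^ k\<close>; the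
  odometer adds 1.\<close>

primrec res :: "(nat \<Rightarrow> bool) \<Rightarrow> nat \<Rightarrow> int" where
  "res w 0 = 0"
| "res w (Suc k) = res w k + (if w k then 2 ^ k else 0)"

definition odometer :: "(nat \<Rightarrow> bool) \<Rightarrow> nat \<Rightarrow> bool" where
  "odometer w = (\<lambda>i. w i \<noteq> (\<forall>j<i. w j))"

lemma res_bounds: "0 \<le> res w k \<and> res w k < 2 ^ k"
  by (induction k) auto

lemma res_dvd_diff: "l \<le> k \<Longrightarrow> 2 ^ l dvd res w k - res w l"
proof (induction k)
  case (Suc k)
  show ?case
  proof (cases "l = Suc k")
    case False
    then have "l \<le> k" using Suc by simp
    then have "2 ^ l dvd (res w k - res w l) + (if w k then 2 ^ k else 0 :: int)"
      using Suc.IH by (intro dvd_add) (auto intro: le_imp_power_dvd)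
    then show ?thesis by (simp add: algebra_simps)
  qed simp
qed simp

lemma dvd_res_iff: "l \<le> k \<Longrightarrow> 2 ^ l dvd res w l + n \<longleftrightarrow> 2 ^ l dvd res w k + n"
  using dvd_add_right_iff[OF res_dvd_diff[of l k w], of "res w l + n"] by simp

text \<open>This links the carry condition in \<open>odometer\<close> to the one residue at which
  adding 1 wraps around.\<close>

lemma res_all_ones: "(\<forall>j<k. w j) \<longleftrightarrow> res w k = 2 ^ k - 1"
proof (induction k)
  case (Suc k)
  then show ?case using res_bounds[of w k] by (auto simp: less_Suc_eq)
qed simp

lemma res_odometer': "res (odometer w) k = (if \<forall>j<k. w j then 0 else res w k + 1)"
proof (induction k)
  case (Suc k)
  then show ?case using res_all_ones[of k w]
    by (auto simp: odometer_def less_Suc_eq)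
qed simp

lemma res_odometer: "res (odometer w) k = (res w k + 1) mod 2 ^ k"
proof (cases "\<forall>j<k. w j")
  case True
  then show ?thesis using res_all_ones[of k w] by (simp add: res_odometer')
next
  case False
  then have "res w k + 1 < 2 ^ k"
    using res_all_ones[of k w] res_bounds[of w k] by auto
  with False show ?thesis using res_bounds[of w k] by (simp add: res_odometer')
qed

lemma res_inj: "res v k = res w k \<Longrightarrow> i < k \<Longrightarrow> v i = w i"
proof (induction k)
  case (Suc k)
  have "v k = w k" and "res v k = res w k"
    using Suc.prems(1) res_bounds[of v k] res_bounds[of w k] by (auto split: if_splits)
  then show ?case using Suc by (auto simp: less_Suc_eq)
qed simp

lemma res_cong: "(\<And>i. i < k \<Longrightarrow> v i = w i) \<Longrightarrow> res v k = res w k"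
  by (induction k) auto

lemma res_odometer_iterate:
  "res ((odometer ^^ n) (\<lambda>_. False)) k = int n mod 2 ^ k"
proof (induction n)
  case 0
  show ?case by (induction k) auto
next
  case (Suc n)
  then show ?case by (simp add: res_odometer mod_simps add.commute)
qed

lemma res_surj:
  assumes "0 \<le> c" "c < 2 ^ k"
  obtains w where "res w k = c"
proof
  show "res ((odometer ^^ nat c) (\<lambda>_. False)) k = c"
    using assms by (simp add: res_odometer_iterate)
qed

section \<open>Haar measure on the 2-adic integers as fair coin flips\<close>

definition coin_flips :: "(nat \<Rightarrow> bool) measure" where
  "coin_flips = Pi\<^sub>M UNIV (\<lambda>_. uniform_count_measure UNIV)"

lemma space_coin_flips [simp]: "space coin_flips = UNIV"
  by (simp add: coin_flips_def space_PiM space_uniform_count_measure)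

interpretation coin: product_prob_space "\<lambda>_::nat. uniform_count_measure (UNIV :: bool set)" UNIV
  by (intro product_prob_spaceI prob_space_uniform_count_measure) auto

interpretation coin_flips: prob_space coin_flips
  unfolding coin_flips_def by (rule coin.prob_space_axioms)

lemma sets_coin: "sets (uniform_count_measure (UNIV :: bool set)) = sets (count_space UNIV)"
  by (simp add: sets_uniform_count_measure)

lemma measurable_coordinate [measurable]:
  "(\<lambda>w. w i) \<in> measurable coin_flips (count_space UNIV)"
  unfolding coin_flips_def measurable_cong_sets[OF refl sets_coin, symmetric]
  by (rule measurable_component_singleton) simp

lemma cylinder_eq: "res v k = c \<Longrightarrow> {w. res w k = c} = {w. \<forall>i<k. w i = v i}"
  by (intro Collect_cong iffI) (blast dest: res_inj, metis res_cong)

lemma cylinder_sets: "{w. res w k = c} \<in> sets coin_flips"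
proof (cases "\<exists>v. res v k = c")
  case True
  then obtain v where v: "res v k = c" ..
  have "{w \<in> space coin_flips. \<forall>i<k. w i = v i} \<in> sets coin_flips"
    by measurable
  then show ?thesis by (simp add: cylinder_eq[OF v])
next
  case False
  then have "{w. res w k = c} = {}" by blast
  then show ?thesis by simp
qed

lemma measurable_res: "(\<lambda>w. res w k) \<in> measurable coin_flips (count_space UNIV)"
proof -
  have "(\<lambda>w. res w k) -` {c} \<inter> space coin_flips \<in> sets coin_flips" for c
    using cylinder_sets[of k c] by (simp add: vimage_def)
  then show ?thesis by (simp add: measurable_count_space_eq2_countable)
qed

lemma measure_cylinder:
  assumes "0 \<le> c" "c < 2 ^ k"
  shows "measure coin_flips {w. res w k = c} = 1 / 2 ^ k"
proof -
  obtain v where v: "res v k = c" using res_surj[OF assms] .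
  have space: "space (Pi\<^sub>M UNIV (\<lambda>_::nat. uniform_count_measure (UNIV :: bool set))) = UNIV"
    using space_coin_flips by (simp only: coin_flips_def)
  have half: "emeasure (uniform_count_measure (UNIV :: bool set)) {b} = ennreal (1 / 2)" for b
    by (subst emeasure_uniform_count_measure) simp_all
  have "emeasure coin_flips {w. \<forall>i\<in>{..<k}. w i \<in> {v i}} =
      (\<Prod>i<k. emeasure (uniform_count_measure (UNIV :: bool set)) {v i})"
    using coin.emeasure_PiM_Collect[of "{..<k}" "\<lambda>i. {v i}"]
    unfolding space coin_flips_def sets_coin by simp
  also have "\<dots> = ennreal (1 / 2 ^ k)"
    unfolding half prod_constant card_lessThan
    by (subst ennreal_power) (simp_all add: power_one_over )
  finally have "emeasure coin_flips {w. res w k = c} = ennreal (1 / 2 ^ k)"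
    by (simp add: cylinder_eq[OF v] Ball_def)
  then show ?thesis by (simp add: measure_def)
qed

definition cylinders :: "(nat \<Rightarrow> bool) set set" where
  "cylinders = range (\<lambda>(k, c). {w. res w k = c})"

lemma cylinder_in_cylinders: "{w. res w k = c} \<in> cylinders"
  unfolding cylinders_def by (rule image_eqI[of _ _ "(k, c)"]) simp_all

text \<open>Two residue classes modulo powers of 2 are nested or disjoint.\<close>

lemma Int_stable_cylinders: "Int_stable cylinders"
proof -
  have *: "{w. res w k = c} \<inter> {w. res w l = d} \<in> cylinders" if "k \<le> l" for k l c d
  proof (cases "2 ^ k dvd d - c \<and> 0 \<le> c \<and> c < 2 ^ k")
    case True
    have "res w k = c" if "res w l = d" for w
    proof -
      have "2 ^ k dvd res w k - c"
        using dvd_diff[of "2 ^ k" "d - c" "d - res w k"] True that res_dvd_diff[OF \<open>k \<le> l\<close>, of w] by simp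
      then have "res w k mod 2 ^ k = c mod 2 ^ k" by (simp add: mod_eq_dvd_iff)
      then show ?thesis using True res_bounds[of w k] by simp
    qed
    then have "{w. res w k = c} \<inter> {w. res w l = d} = {w. res w l = d}" by auto
    then show ?thesis by (simp only: cylinder_in_cylinders)
  next
    case False
    \<comment> \<open>Residues at level 0 are 0, so this cylinder is the empty set.\<close>
    then have "{w. res w k = c} \<inter> {w. res w l = d} = {w. res w 0 = 1}"
      using res_bounds[of _ k] res_dvd_diff[OF that] by auto
    then show ?thesis by (simp only: cylinder_in_cylinders)
  qed
  show ?thesis
  proof (rule Int_stableI)
    fix a b assume "a \<in> cylinders" "b \<in> cylinders"
    then obtain k c l d where "a = {w. res w k = c}" "b = {w. res w l = d}"
      by (auto simp: cylinders_def)
    then show "a \<inter> b \<in> cylinders"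
      using *[of k l c d] *[of l k d c] by (cases "k \<le> l") (auto simp: Int_commute)
  qed
qed

lemma sets_coin_flips: "sets coin_flips = sigma_sets UNIV cylinders"
proof
  interpret S: sigma_algebra UNIV "sigma_sets UNIV cylinders"
    by (rule sigma_algebra_sigma_sets) simp
  have coord: "{w. w i = b} \<in> sigma_sets UNIV cylinders" for i b
  proof -
    \<comment> \<open>Bit \<open>i\<close> is determined by the residue at level
      \<open>i + 1\<close>, and the union is countable since residues are integers.\<close>
    have "{w. w i = b} = (\<Union>c\<in>(\<lambda>w. res w (Suc i)) ` {w. w i = b}. {w. res w (Suc i) = c})"
      using res_inj[of _ "Suc i" _ i] by (auto simp del: res.simps)
    also have "\<dots> \<in> sigma_sets UNIV cylinders"
      by (intro S.countable_UN'' sigma_sets.Basic cylinder_in_cylinders) simp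
    finally show ?thesis .
  qed
  have "{w. w i \<in> A} \<in> sigma_sets UNIV cylinders" for i A
  proof -
    have "{w. w i \<in> A} = (\<Union>b\<in>A. {w. w i = b})" by auto
    also have "\<dots> \<in> sigma_sets UNIV cylinders"
      by (intro S.countable_UN'' coord) auto
    finally show ?thesis .
  qed
  moreover have "sets coin_flips = sigma_sets UNIV {{f. f i \<in> A} | i A. True}"
    unfolding coin_flips_def sets_PiM_single
    by (simp add: space_uniform_count_measure sets_uniform_count_measure PiE_UNIV_domain)
  ultimately show "sets coin_flips \<subseteq> sigma_sets UNIV cylinders"
    by (auto intro!: S.sigma_sets_subset)
  have "cylinders \<subseteq> sets coin_flips"
    by (auto simp: cylinders_def cylinder_sets)
  then show "sigma_sets UNIV cylinders \<subseteq> sets coin_flips"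
    using sets.sigma_sets_subset[of cylinders coin_flips] unfolding space_coin_flips by simp
qed

lemma measurable_odometer [measurable]: "odometer \<in> measurable coin_flips coin_flips"
proof -
  have sets: "sets (uniform_count_measure (UNIV :: bool set)) = sets (count_space UNIV)"
    by (simp add: sets_uniform_count_measure)
  have "(\<lambda>w. odometer w i) \<in> measurable coin_flips (count_space UNIV)" for i
    unfolding odometer_def by measurable
  then have "(\<lambda>w. odometer w i) \<in> measurable coin_flips (uniform_count_measure UNIV)" for i
    using measurable_cong_sets[OF refl sets] by blast
  then have "(\<lambda>w i. odometer w i) \<in>
      measurable coin_flips (Pi\<^sub>M UNIV (\<lambda>_. uniform_count_measure UNIV))"
    by (rule measurable_PiM_single') (auto simp: space_uniform_count_measure)
  then show ?thesis by (simp add: coin_flips_def)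
qed

text \<open>Uniqueness of measures on an intersection-stable generator; cylinders with
  \<open>c\<close> out of range are empty.\<close>

lemma measure_eq_coin_flipsI:
  assumes "sets M = sets coin_flips" "sets N = sets coin_flips" "finite_measure M"
    and "\<And>k c. 0 \<le> c \<Longrightarrow> c < 2 ^ k \<Longrightarrow> emeasure M {w. res w k = c} = emeasure N {w. res w k = c}"
  shows "M = N"
proof (rule measure_eqI_generator_eq[OF Int_stable_cylinders])
  interpret finite_measure M by fact
  show "cylinders \<subseteq> Pow UNIV" by simp
  show "sets M = sigma_sets UNIV cylinders" "sets N = sigma_sets UNIV cylinders"
    using assms sets_coin_flips by auto
  show "emeasure M X = emeasure N X" if "X \<in> cylinders" for X
  proof -
    obtain k c where X: "X = {w. res w k = c}" using \<open>X \<in> cylinders\<close> by (auto simp: cylinders_def)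
    show ?thesis
    proof (cases "0 \<le> c \<and> c < 2 ^ k")
      case False
      then have "X = {}" using X res_bounds[of _ k] by auto
      then show ?thesis by simp
    qed (use assms X in auto)
  qed
  \<comment> \<open>The level 0 cylinder is the whole space, so a constant sequence exhausts
    it.\<close>
  show "range (\<lambda>_::nat. {w. res w 0 = 0}) \<subseteq> cylinders"
    using cylinder_in_cylinders[of 0 0] by auto
qed (auto simp: finite_measure.emeasure_finite[OF assms(3)])

text \<open>Adding 1 permutes the residue classes of each level, and these all have the same
  mass.\<close>

lemma distr_odometer: "distr coin_flips coin_flips odometer = coin_flips"
proof (rule measure_eq_coin_flipsI)
  fix k and c :: int assume c: "0 \<le> c" "c < 2 ^ k"
  have "(r + 1) mod 2 ^ k = c \<longleftrightarrow> r = (c - 1) mod 2 ^ k" if "0 \<le> r" "r < 2 ^ k" for r :: int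
  proof
    assume "(r + 1) mod 2 ^ k = c"
    then have "(c - 1) mod 2 ^ k = (r + 1 - 1) mod 2 ^ k" by (metis mod_diff_left_eq)
    then show "r = (c - 1) mod 2 ^ k" using that by simp
  next
    assume "r = (c - 1) mod 2 ^ k"
    then have "(r + 1) mod 2 ^ k = (c - 1 + 1) mod 2 ^ k" by (metis mod_add_left_eq)
    then show "(r + 1) mod 2 ^ k = c" using c by simp
  qed
  then have "odometer -` {w. res w k = c} = {w. res w k = (c - 1) mod 2 ^ k}"
    using res_bounds by (auto simp: res_odometer)
  then have "emeasure (distr coin_flips coin_flips odometer) {w. res w k = c} =
      emeasure coin_flips {w. res w k = (c - 1) mod 2 ^ k}"
    by (simp add: emeasure_distr cylinder_sets)
  also have "\<dots> = emeasure coin_flips {w. res w k = c}"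
    using c by (simp add: coin_flips.emeasure_eq_measure measure_cylinder)
  finally show "emeasure (distr coin_flips coin_flips odometer) {w. res w k = c} =
      emeasure coin_flips {w. res w k = c}" .
qed (simp_all add: prob_space.finite_measure coin_flips.prob_space_distr)

text \<open>The odometer permutes the cylinders of each level cyclically, so an invariant event is
  independent of every cylinder, hence of itself.\<close>

lemma odometer_ergodic:
  assumes B: "B \<in> sets coin_flips" and inv: "odometer -` B = B"
  shows "measure coin_flips B = 0 \<or> measure coin_flips B = 1"
proof -
  have step: "measure coin_flips (B \<inter> {w. res w k = int n}) = measure coin_flips (B \<inter> {w. res w k = 0})"
    if "int n < 2 ^ k" for k n
    using that
  proof (induction n)
    case (Suc n)
    \<comment> \<open>Wrapping around would give residue 0, while the target here is positive and
      below \<open>2 ^ k\<close>.\<close>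
    have "res (odometer w) k = int (Suc n) \<longleftrightarrow> res w k = int n" for w
    proof -
      have "res w k = 2 ^ k - 1 \<or> res w k + 1 < 2 ^ k" using res_bounds[of w k] by linarith
      then show ?thesis using Suc.prems res_bounds[of w k] by (auto simp: res_odometer)
    qed
    then have "odometer -` (B \<inter> {w. res w k = int (Suc n)}) = B \<inter> {w. res w k = int n}"
      using inv by auto
    then have "measure (distr coin_flips coin_flips odometer) (B \<inter> {w. res w k = int (Suc n)}) =
        measure coin_flips (B \<inter> {w. res w k = int n})"
      using B by (subst measure_distr) (auto simp: cylinder_sets simp del: of_nat_Suc)
    moreover have "int n < 2 ^ k"
      by (rule less_trans[OF _ Suc.prems]) simp
    ultimately show ?case using Suc.IH by (simp only: distr_odometer)
  qed simp
  have indep: "measure coin_flips (B \<inter> {w. res w k = c}) = measure coin_flips B / 2 ^ k"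
    if c: "0 \<le> c" "c < 2 ^ k" for k c
  proof -
    have eq: "measure coin_flips (B \<inter> {w. res w k = d}) = measure coin_flips (B \<inter> {w. res w k = 0})"
      if "d \<in> {0..<2 ^ k}" for d
      using step[of "nat d" k] that by simp
    have "B = (\<Union>d\<in>{0..<2 ^ k}. B \<inter> {w. res w k = d})"
      using res_bounds by auto
    then have "measure coin_flips B = measure coin_flips (\<Union>d\<in>{0..<2 ^ k}. B \<inter> {w. res w k = d})"
      by simp
    also have "\<dots> = (\<Sum>d\<in>{0..<2 ^ k}. measure coin_flips (B \<inter> {w. res w k = d}))"
      using B by (intro coin_flips.finite_measure_finite_Union)
        (auto simp: disjoint_family_on_def cylinder_sets)
    also have "\<dots> = (\<Sum>d\<in>{0..<2 ^ k :: int}. measure coin_flips (B \<inter> {w. res w k = c}))"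
      by (intro sum.cong refl) (metis eq c atLeastLessThan_iff)
    also have "\<dots> = 2 ^ k * measure coin_flips (B \<inter> {w. res w k = c})"
      by (simp add: nat_power_eq)
    finally show ?thesis by simp
  qed
  define p where "p = measure coin_flips B"
  \<comment> \<open>\<open>M\<close> and \<open>N\<close> send \<open>A\<close> to the mass of
    \<open>B \<inter> A\<close> and to \<open>p\<close> times the mass of \<open>A\<close>. They
    agree on cylinders by independence, hence everywhere, and \<open>A = B\<close> gives
    \<open>p = p * p\<close>.\<close>
  define M where "M = density coin_flips (indicator B)"
  define N where "N = scale_measure (ennreal p) coin_flips"
  have M: "emeasure M A = ennreal (measure coin_flips (B \<inter> A))" if "A \<in> sets coin_flips" for A
    using that B by (simp add: M_def emeasure_density coin_flips.emeasure_eq_measure[symmetric]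
        nn_integral_indicator' indicator_inter_arith[symmetric])
  have N: "emeasure N A = ennreal (p * measure coin_flips A)" for A
    by (simp add: N_def coin_flips.emeasure_eq_measure ennreal_mult p_def)
  have "M = N"
  proof (rule measure_eq_coin_flipsI)
    show "finite_measure M"
    proof (rule finite_measureI)
      have "space M = UNIV" by (simp add: M_def)
      moreover have "UNIV \<in> sets coin_flips" using sets.top[of coin_flips] by simp
      ultimately show "emeasure M (space M) \<noteq> \<infinity>" by (simp only: M) simp
    qed
    show "emeasure M {w. res w k = c} = emeasure N {w. res w k = c}"
      if "0 \<le> c" "c < 2 ^ k" for k c
      using that by (simp add: M N cylinder_sets indep measure_cylinder p_def)
  qed (auto simp: M_def N_def)
  then have "p = p * p"
    using M[OF B] N[of B] by (simp add: p_def)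
  then show ?thesis by (auto simp: p_def)
qed

section \<open>The period-doubling coding\<close>

text \<open>The symbol at \<open>n\<close> records the parity of one more than the 2-adic valuation of \<open>w + n\<close>.
  If \<open>w + n = 0\<close>, the \<open>LEAST\<close> is unspecified; no lemma depends on that value.\<close>

definition toeplitz :: "(nat \<Rightarrow> bool) \<Rightarrow> full_shift" where
  "toeplitz w n = odd (LEAST k. \<not> 2 ^ k dvd res w k + n)"

text \<open>The coding depends on \<open>w\<close> and \<open>n\<close> only through the 2-adic
  integer \<open>w + n\<close>.\<close>

lemma toeplitz_odometer: "toeplitz (odometer w) = shift (toeplitz w)"
proof
  fix n
  have "2 ^ k dvd res (odometer w) k + n \<longleftrightarrow> 2 ^ k dvd res w k + (n + 1)" for k
    by (simp add: res_odometer dvd_eq_mod_eq_0 mod_simps algebra_simps)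
  then show "toeplitz (odometer w) n = shift (toeplitz w) n"
    by (simp add: toeplitz_def shift_def)
qed

text \<open>At valuation \<open>a\<close> the least failing exponent is \<open>a + 1\<close>, whose
  oddness is the evenness of \<open>a\<close>. Any level above \<open>a\<close> suffices to see
  this.\<close>

lemma toeplitz_eval:
  assumes "k > a" "2 ^ a dvd res w k + n" "\<not> 2 ^ Suc a dvd res w k + n"
  shows "toeplitz w n = even a"
proof -
  have "(LEAST l. \<not> 2 ^ l dvd res w l + n) = Suc a"
  proof (rule Least_equality)
    show "\<not> 2 ^ Suc a dvd res w (Suc a) + n"
      using assms dvd_res_iff[of "Suc a" k w n] by simp
    fix l assume l: "\<not> 2 ^ l dvd res w l + n"
    show "Suc a \<le> l"
    proof (rule ccontr)
      assume "\<not> Suc a \<le> l"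
      then have "(2::int) ^ l dvd 2 ^ a" by (simp add: le_imp_power_dvd)
      then have "2 ^ l dvd res w k + n" using assms(2) dvd_trans by blast
      then show False using l dvd_res_iff[of l k w n] assms(1) \<open>\<not> Suc a \<le> l\<close> by simp
    qed
  qed
  then show ?thesis by (simp add: toeplitz_def)
qed

lemma two_power_odd:
  assumes "m > 0"
  obtains a b :: nat where "m = 2 ^ a * b" "odd b"
  using assms
proof (induction m arbitrary: thesis rule: less_induct)
  case (less m)
  show ?case
  proof (cases "odd m")
    case True
    then show ?thesis using less.prems(1)[of 0 m] by simp
  next
    case False
    then obtain l where l: "m = 2 * l" by blast
    with less.prems(2) have "l < m" "l > 0" by auto
    then obtain a b where "l = 2 ^ a * b" "odd b" using less.IH by blast
    then show ?thesis using less.prems(1)[of "Suc a" b] l by simp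
  qed
qed

text \<open>If \<open>2 ^ a\<close> is the exact power of 2 in \<open>m\<close>, some \<open>j < 2 ^ (a + 2)\<close> has valuation
  \<open>a\<close> at \<open>j\<close> and \<open>a + 1\<close> at \<open>j + m\<close>.\<close>

lemma toeplitz_aperiodic:
  assumes "m > 0"
  obtains j where "j + m < 5 * m" "toeplitz w (int j) \<noteq> toeplitz w (int (j + m))"
proof -
  obtain a b where m: "m = 2 ^ a * b" "odd b" using two_power_odd[OF assms] .
  define r where "r = res w (a + 2)"
  \<comment> \<open>This \<open>j\<close> solves \<open>r + j = 2 ^ a * (2 - b)\<close> modulo
    \<open>2 ^ (a + 2)\<close>. As \<open>2 - b\<close> is odd, the valuation is \<open>a\<close>;
    adding \<open>m = 2 ^ a * b\<close> gives \<open>2 ^ (a + 1)\<close> modulo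
    \<open>2 ^ (a + 2)\<close>.\<close>
  define j where "j = nat ((2 ^ a * (2 - int b) - r) mod 2 ^ (a + 2))"
  have j: "int j = (2 ^ a * (2 - int b) - r) mod 2 ^ (a + 2)"
    by (simp add: j_def)
  define q where "q = - ((2 ^ a * (2 - int b) - r) div 2 ^ (a + 2))"
  have "int j = 2 ^ a * (2 - int b) - r + 2 ^ (a + 2) * q"
    unfolding j q_def using minus_mult_div_eq_mod[of "2 ^ a * (2 - int b) - r" "2 ^ (a + 2)"] by simp
  then have rj: "r + int j = 2 ^ a * (2 - int b + 4 * q)"
    by (simp add: algebra_simps power_add)
  then have rjm: "r + int (j + m) = 2 ^ Suc a * (1 + 2 * q)"
    by (simp add: m algebra_simps)
  have "toeplitz w (int j) = even a"
  proof (rule toeplitz_eval)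
    show "2 ^ a dvd res w (a + 2) + int j"
      unfolding r_def[symmetric] rj by simp
    show "\<not> 2 ^ Suc a dvd res w (a + 2) + int j"
      using m(2) unfolding r_def[symmetric] rj by simp
  qed simp
  moreover have "toeplitz w (int (j + m)) = even (Suc a)"
  proof (rule toeplitz_eval)
    show "2 ^ Suc a dvd res w (a + 2) + int (j + m)"
      unfolding r_def[symmetric] rjm by simp
    show "\<not> 2 ^ Suc (Suc a) dvd res w (a + 2) + int (j + m)"
      unfolding r_def[symmetric] rjm power_Suc2[of _ "Suc a"]
      by (subst dvd_times_left_cancel_iff) simp_all
  qed simp
  \<comment> \<open>Origin of the constant 5: \<open>j < 4 * 2 ^ a \<le> 4 * m\<close>, plus one
    more period.\<close>
  moreover have "j + m < 5 * m"
  proof -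
    have "int j < 2 ^ (a + 2)" unfolding j by simp
    then have "int j < int (4 * 2 ^ a)" by simp
    then have "j < 4 * 2 ^ a" by (simp only: of_nat_less_iff)
    also have "\<dots> \<le> 4 * m" using m by (simp add: odd_pos Suc_leI)
    finally show ?thesis by simp
  qed
  ultimately show thesis using that by simp
qed

text \<open>Reading from position 0 captures the factors at all later positions, since iterating the
  odometer brings them to 0.\<close>

definition toeplitz_words :: "bool list set" where
  "toeplitz_words = {u. \<exists>w. \<forall>i<length u. u ! i = toeplitz w (int i)}"

lemma toeplitz_odometer_iterate: "toeplitz ((odometer ^^ i) w) n = toeplitz w (n + int i)"
  by (induction i arbitrary: n) (auto simp: toeplitz_odometer shift_def algebra_simps)

lemma toeplitz_factor: "map (\<lambda>j. toeplitz w (int j)) [i..<n] \<in> toeplitz_words"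
  unfolding toeplitz_words_def
  by (auto simp: toeplitz_odometer_iterate add.commute intro!: exI[of _ "(odometer ^^ i) w"])

text \<open>Period \<open>m\<close> contradicts the mismatch at distance \<open>m\<close> from
  \<open>toeplitz_aperiodic\<close>, which lies within the first \<open>5 * m\<close> letters. The
  tail \<open>v\<close> matches the hypothesis of \<open>gain_append_le\<close>.\<close>

lemma periodic_not_toeplitz:
  assumes "m > 0" "\<And>n. p (n + int m) = p n"
  shows "map (\<lambda>j. p (int j)) [i..<i + 5 * m] @ v \<notin> toeplitz_words"
proof
  let ?u = "map (\<lambda>j. p (int j)) [i..<i + 5 * m] @ v"
  assume "?u \<in> toeplitz_words"
  then obtain w where w: "\<And>k. k < length ?u \<Longrightarrow> ?u ! k = toeplitz w (int k)"
    by (auto simp: toeplitz_words_def)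
  have eq: "toeplitz w (int k) = p (int (i + k))" if "k < 5 * m" for k
    using w[of k] that by (simp add: nth_append)
  obtain j where j: "j + m < 5 * m" "toeplitz w (int j) \<noteq> toeplitz w (int (j + m))"
    using toeplitz_aperiodic[OF assms(1)] .
  then show False
    using eq[of j] eq[of "j + m"] assms(2)[of "int (i + j)"] by (simp add: algebra_simps)
qed

section \<open>The shift-invariant measure\<close>

text \<open>With second countable factors, the Borel sets of the shift space are those of the
  product sigma-algebra, so measurability can be checked by coordinates.\<close>

instance bool :: second_countable_topology
proof
  show "\<exists>B :: bool set set. countable B \<and> open = generate_topology B"
    using open_bool_def by (intro exI[of _ "range lessThan \<union> range greaterThan"]) simp
qed

lemma open_coordinate: "open {x :: full_shift. x i = b}"
proof -
  have "open ((\<lambda>x :: full_shift. x i) -` {b})"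
    by (intro open_vimage continuous_on_product_coordinates Topological_Spaces.open_discrete)
  then show ?thesis by (simp add: vimage_def)
qed

lemma measurable_symbol [measurable]: "(\<lambda>x :: full_shift. x i) \<in> measurable borel (count_space UNIV)"
proof -
  have "(\<lambda>x :: full_shift. x i) -` {b} \<in> sets borel" for b
    using borel_open[OF open_coordinate[of i b]] by (simp add: vimage_def)
  then show ?thesis by (simp add: measurable_count_space_eq2_countable)
qed

lemma measurable_into_full_shift:
  assumes "\<And>n. (\<lambda>w. f w n) \<in> measurable M (count_space UNIV)"
  shows "f \<in> measurable M (borel :: full_shift measure)"
proof -
  have "(\<lambda>w. f w n) \<in> borel_measurable M" for n
    by (rule measurable_compose[OF assms, of "\<lambda>b. b"]) simp
  then have "(\<lambda>w n. f w n) \<in> measurable M (Pi\<^sub>M UNIV (\<lambda>_. borel))"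
    by (rule measurable_PiM_single') simp
  then show ?thesis
    by (simp only: measurable_cong_sets[OF refl sets_PiM_equal_borel])
qed

lemma measurable_shift: "shift \<in> measurable borel borel"
  by (rule measurable_into_full_shift) (simp add: shift_def measurable_symbol)

lemma measurable_toeplitz: "toeplitz \<in> measurable coin_flips borel"
proof (rule measurable_into_full_shift)
  fix n
  have "(\<lambda>w. \<not> 2 ^ k dvd res w k + n) \<in> measurable coin_flips (count_space UNIV)" for k
    by (rule measurable_compose[OF measurable_res, of "\<lambda>r. \<not> 2 ^ k dvd r + n"]) simp
  then have "(\<lambda>w. LEAST k. \<not> 2 ^ k dvd res w k + n) \<in> measurable coin_flips (count_space UNIV)"
    by (rule measurable_Least)
  then show "(\<lambda>w. toeplitz w n) \<in> measurable coin_flips (count_space UNIV)"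
    unfolding toeplitz_def by (rule measurable_compose[where g = odd]) simp
qed

definition toeplitz_measure :: "full_shift measure" where
  "toeplitz_measure = distr coin_flips borel toeplitz"

lemma prob_space_toeplitz: "prob_space toeplitz_measure"
  unfolding toeplitz_measure_def by (rule coin_flips.prob_space_distr[OF measurable_toeplitz])

text \<open>\<open>toeplitz\<close> intertwines odometer and shift, so invariance and ergodicity
  pass from Haar measure to its image: a shift-invariant event pulls back to an odometer-invariant
  one.\<close>

lemma ergodic_toeplitz: "ergodic_invariant_prob toeplitz_measure"
  unfolding ergodic_invariant_prob_def
proof (intro conjI ballI impI)
  show "prob_space toeplitz_measure" by (rule prob_space_toeplitz)
  show "sets toeplitz_measure = sets borel" by (simp add: toeplitz_measure_def)
  have comm: "shift \<circ> toeplitz = toeplitz \<circ> odometer"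
    by (auto simp: toeplitz_odometer)
  have "distr toeplitz_measure borel shift = distr coin_flips borel (toeplitz \<circ> odometer)"
    unfolding toeplitz_measure_def comm[symmetric]
    by (rule distr_distr[OF measurable_shift measurable_toeplitz])
  also have "\<dots> = distr (distr coin_flips coin_flips odometer) borel toeplitz"
    by (rule distr_distr[OF measurable_toeplitz measurable_odometer, symmetric])
  finally show "distr toeplitz_measure borel shift = toeplitz_measure"
    by (simp add: distr_odometer toeplitz_measure_def)
  fix B :: "full_shift set" assume B: "B \<in> sets borel" "shift -` B = B"
  have "toeplitz -` B \<in> sets coin_flips"
    using measurable_sets[OF measurable_toeplitz B(1)] by simp
  moreover have "odometer -` (toeplitz -` B) = toeplitz -` (shift -` B)"
    by (auto simp: toeplitz_odometer)
  moreover have "measure toeplitz_measure B = measure coin_flips (toeplitz -` B)"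
    unfolding toeplitz_measure_def using measure_distr[OF measurable_toeplitz B(1)] by simp
  ultimately show "measure toeplitz_measure B = 0 \<or> measure toeplitz_measure B = 1"
    using odometer_ergodic B(2) by simp
qed

abbreviation word_at :: "full_shift \<Rightarrow> nat \<Rightarrow> nat \<Rightarrow> bool list" where
  "word_at x i n \<equiv> map (\<lambda>j. x (int j)) [i..<n]"

lemma toeplitz_words_suffix:
  assumes "word_at x 0 n \<in> toeplitz_words"
  shows "word_at x i n \<in> toeplitz_words"
proof -
  obtain w where "\<And>j. j < n \<Longrightarrow> x (int j) = toeplitz w (int j)"
    using assms by (auto simp: toeplitz_words_def)
  then have "word_at x i n = word_at (toeplitz w) i n"
    by simp
  then show ?thesis by (simp only: toeplitz_factor)
qed

text \<open>Every value of \<open>toeplitz\<close> has the property; the work lies in the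
  measurability of the event, which lets \<open>AE_distr_iff\<close> transfer it.\<close>

lemma AE_toeplitz_words: "AE x in toeplitz_measure. \<forall>n. word_at x 0 n \<in> toeplitz_words"
proof -
  have "{x :: full_shift. word_at x 0 n = u} \<in> sets borel" for n u
  proof (cases "length u = n")
    case True
    have "{x \<in> space (borel :: full_shift measure). \<forall>j<n. x (int j) = u ! j} \<in> sets borel"
      by measurable
    moreover have "{x :: full_shift. word_at x 0 n = u} = {x. \<forall>j<n. x (int j) = u ! j}"
      using True by (auto simp: list_eq_iff_nth_eq)
    ultimately show ?thesis by simp
  next
    case False
    then have "{x :: full_shift. word_at x 0 n = u} = {}" by auto
    then show ?thesis by simp
  qed
  then have word: "(\<lambda>x. word_at x 0 n) \<in> measurable borel (count_space UNIV)" for n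
    by (simp add: measurable_count_space_eq2_countable vimage_def)
  have meas: "{x \<in> space (borel :: full_shift measure). \<forall>n. word_at x 0 n \<in> toeplitz_words} \<in> sets borel"
    using measurable_compose[OF word, of "\<lambda>u. u \<in> toeplitz_words" "count_space UNIV"]
    by (intro sets.sets_Collect_countable_All) (simp add: pred_def)
  show ?thesis
    unfolding toeplitz_measure_def AE_distr_iff[OF measurable_toeplitz meas]
    by (rule AE_I2) (intro allI toeplitz_factor)
qed

section \<open>The cocycle and its exponents\<close>

text \<open>The theorem asks for a space of functions on the naturals, so the countable vertex set
  is enumerated.\<close>

definition code :: "vertex \<Rightarrow> nat" where
  "code = to_nat_on UNIV"

definition decode :: "nat \<Rightarrow> vertex" where
  "decode = from_nat_into UNIV"

lemma infinite_vertices: "infinite (UNIV :: vertex set)"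
  by (simp add: finite_prod infinite_UNIV_listI)

lemma code_inverse [simp]: "decode (code s) = s" "code (decode n) = n"
  using infinite_vertices by (simp_all add: code_def decode_def)

definition weight :: "nat \<Rightarrow> real" where
  "weight s = 2 ^ height toeplitz_words (decode s)"

definition lift :: "(vertex \<Rightarrow> vertex) \<Rightarrow> nat \<Rightarrow> nat" where
  "lift g = code \<circ> g \<circ> decode"

lemma lift_comp: "lift g \<circ> lift h = lift (g \<circ> h)"
  by (simp add: lift_def fun_eq_iff)

lemma lift_id: "lift id = id"
  by (simp add: lift_def fun_eq_iff)

abbreviation WV :: "(nat \<Rightarrow> real) normed_space" where
  "WV \<equiv> weighted_linf weight"

interpretation WV: weighted_space weight
  by unfold_locales (simp add: weight_def)

definition generator :: "full_shift \<Rightarrow> (nat \<Rightarrow> real) \<Rightarrow> nat \<Rightarrow> real" where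
  "generator x = pull weight (lift (push (x 0)))"

lemma weight_lift_le:
  assumes "\<And>v. height toeplitz_words (g v) \<le> height toeplitz_words v + N"
  shows "weight (lift g s) \<le> 2 ^ N * weight s"
proof -
  have "(2 :: real) ^ height toeplitz_words (g (decode s)) \<le> 2 ^ (height toeplitz_words (decode s) + N)"
    using assms by (intro power_increasing) auto
  then show ?thesis by (simp add: weight_def lift_def power_add mult.commute)
qed

lemma generator_in_GL: "generator x \<in> carrier (GL WV)"
  unfolding generator_def
proof (rule WV.pull_in_GL)
  show "weight (lift (push (x 0)) s) \<le> 2 ^ 1 * weight s" for s
    by (rule weight_lift_le) (rule height_push)
  \<comment> \<open>\<open>pop\<close> never raises the height, because \<open>push\<close> undoes
    it and never lowers the height.\<close>
  show "weight (lift (pop (x 0)) s) \<le> 2 ^ 0 * weight s" for s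
    using height_push(1)[of toeplitz_words "pop (x 0) _" "x 0"]
    by (intro weight_lift_le) (simp add: push_pop)
  show "lift (push (x 0)) \<circ> lift (pop (x 0)) = id" "lift (pop (x 0)) \<circ> lift (push (x 0)) = id"
    by (simp_all add: lift_def fun_eq_iff push_pop pop_push)
qed

lemma locally_constant_generator: "locally_constant generator"
  unfolding locally_constant_def
proof
  fix x :: full_shift
  have "generator constant_on {y. y 0 = x 0}"
    by (auto simp: constant_on_def generator_def)
  then show "\<exists>U. open U \<and> x \<in> U \<and> generator constant_on U"
    using open_coordinate[of 0 "x 0"] by blast
qed

lemma shift_iterate: "(shift ^^ n) x = (\<lambda>k. x (k + int n))"
  by (induction n) (auto simp: shift_def fun_eq_iff algebra_simps)

text \<open>Precomposition reverses order: the newest cocycle factor, applied last, corresponds to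
  the letter that \<open>push_word\<close> pushes first.\<close>

lemma forward_cocycle_generator:
  "forward_cocycle WV generator x n = pull weight (lift (push_word (\<lambda>j. x (int j)) n))"
proof (induction n)
  case 0
  show ?case
    by (simp add: GL_def units_of_def operator_monoid_def pull_def lift_id del: id_apply)
next
  case (Suc n)
  have "weight (lift (push_word (\<lambda>j. x (int j)) n) s) \<le> 2 ^ n * weight s" for s
    using height_push_word by (intro weight_lift_le) blast
  note pull_pull = WV.pull_compose[OF this, of "lift (push (x (int n)))"]
  have "forward_cocycle WV generator x (Suc n) =
      compose (carrier WV) (generator ((shift ^^ n) x)) (forward_cocycle WV generator x n)"
    by (simp add: GL_def units_of_def operator_monoid_def)
  also have "generator ((shift ^^ n) x) = pull weight (lift (push (x (int n))))"
    by (simp add: generator_def shift_iterate)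
  finally show ?case
    unfolding Suc pull_pull by (simp only: lift_comp push_word.simps)
qed

abbreviation growth :: "full_shift \<Rightarrow> nat \<Rightarrow> real" where
  "growth x n \<equiv> op_norm WV (cocycle WV generator x (int n))"

lemma growth_le:
  assumes "\<And>v. height toeplitz_words (push_word (\<lambda>j. x (int j)) n v) \<le> height toeplitz_words v + N"
  shows "growth x n \<le> 2 ^ N"
  unfolding cocycle_def forward_cocycle_generator
  using WV.op_norm_pull_le[OF weight_lift_le[OF assms]] by (simp add: forward_cocycle_generator)

text \<open>Tests the operator on the extremal vector \<open>weight\<close>, evaluated at the single
  vertex \<open>v\<close>.\<close>

lemma growth_ge:
  "2 ^ height toeplitz_words (push_word (\<lambda>j. x (int j)) n v)
    \<le> growth x n * 2 ^ height toeplitz_words v"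
proof -
  have "weight (lift (push_word (\<lambda>j. x (int j)) n) s) \<le> 2 ^ n * weight s" for s
    using height_push_word by (intro weight_lift_le) blast
  moreover have "weight (lift g (code v)) = 2 ^ height toeplitz_words (g v)" for g
    by (simp add: weight_def lift_def)
  moreover have "weight (code v) = 2 ^ height toeplitz_words v"
    by (simp add: weight_def)
  moreover have "cocycle WV generator x (int n) = pull weight (lift (push_word (\<lambda>j. x (int j)) n))"
    by (simp add: cocycle_def forward_cocycle_generator)
  ultimately show ?thesis
    using WV.op_norm_pull_ge[of "lift (push_word (\<lambda>j. x (int j)) n)" "2 ^ n" "code v"] by simp
qed

section \<open>Values of the Lyapunov exponents\<close>

lemma lyapunov_exponent_eqI:
  assumes "prob_space \<mu>"
    and lim: "AE x in \<mu>. (\<lambda>n. ereal (1 / real n * ln (op_norm V (cocycle V A x (int n))))) \<longlonglongrightarrow> l"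
  shows "lyapunov_exponent V A \<mu> = l"
  unfolding lyapunov_exponent_def
proof (rule the_equality, rule lim)
  interpret prob_space \<mu> by fact
  fix l' assume "AE x in \<mu>. (\<lambda>n. ereal (1 / real n * ln (op_norm V (cocycle V A x (int n))))) \<longlonglongrightarrow> l'"
  \<comment> \<open>A condition independent of the point that holds almost everywhere on a
    probability space is true.\<close>
  with lim have "AE x in \<mu>. l' = l"
    by eventually_elim (rule LIMSEQ_unique)
  then show "l' = l" by simp
qed

text \<open>Starting from the empty word, each of the \<open>n\<close> pushes creates a word in
  \<open>toeplitz_words\<close>, so the maximal rise \<open>n\<close> is attained.\<close>

lemma growth_toeplitz:
  assumes "word_at x 0 n \<in> toeplitz_words"
  shows "growth x n = 2 ^ n"
proof (rule antisym)
  show "growth x n \<le> 2 ^ n"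
    by (rule growth_le) (use height_push_word in blast)
  have "height toeplitz_words (push_word (\<lambda>j. x (int j)) n ([], 0)) = n"
    using toeplitz_words_suffix[OF assms] by (rule height_push_word_full)
  then show "2 ^ n \<le> growth x n"
    using growth_ge[of x n "([], 0)"] by (simp add: height_def)
qed

lemma exponent_toeplitz: "lyapunov_exponent WV generator toeplitz_measure = ereal (ln 2)"
proof (rule lyapunov_exponent_eqI[OF prob_space_toeplitz])
  show "AE x in toeplitz_measure. (\<lambda>n. ereal (1 / real n * ln (growth x n))) \<longlonglongrightarrow> ereal (ln 2)"
    using AE_toeplitz_words
  proof eventually_elim
    fix x :: full_shift assume "\<forall>n. word_at x 0 n \<in> toeplitz_words"
    then have "growth x n = 2 ^ n" for n by (simp add: growth_toeplitz)
    \<comment> \<open>Equality holds only from \<open>n = 1\<close> on: at \<open>n = 0\<close>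
      division by zero makes the left side 0.\<close>
    then have "\<forall>\<^sub>F n in sequentially. ereal (1 / real n * ln (growth x n)) = ereal (ln 2)"
      by (auto simp: eventually_sequentially ln_realpow intro!: exI[of _ 1])
    then show "(\<lambda>n. ereal (1 / real n * ln (growth x n))) \<longlonglongrightarrow> ereal (ln 2)"
      by (rule tendsto_eventually)
  qed
qed

lemma growth_periodic:
  assumes "m > 0" "\<And>k. x (k + int m) = x k"
  shows "1 \<le> growth x n" "growth x n \<le> 2 ^ (5 * m)"
proof -
  show "growth x n \<le> 2 ^ (5 * m)"
    by (rule growth_le, rule height_push_word_bounded, rule periodic_not_toeplitz[where p = x, OF assms])
  have "1 \<le> (2::real) ^ height toeplitz_words (push_word (\<lambda>j. x (int j)) n ([], 0))"
    by (rule one_le_power) simp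
  also have "\<dots> \<le> growth x n * 2 ^ height toeplitz_words ([], 0)"
    by (rule growth_ge)
  finally show "1 \<le> growth x n"
    by (simp add: height_def)
qed

text \<open>The logarithm of the growth lies between 0 and a bound independent of \<open>n\<close>,
  so dividing by \<open>n\<close> sends it to 0.\<close>

lemma exponent_periodic_point:
  assumes "m > 0" "\<And>k. x (k + int m) = x k"
  shows "(\<lambda>n. ereal (1 / real n * ln (growth x n))) \<longlonglongrightarrow> 0"
proof -
  have "(\<lambda>n. 1 / real n * ln (growth x n)) \<longlonglongrightarrow> 0"
  proof (rule tendsto_sandwich[OF always_eventually always_eventually])
    show "\<forall>n. 0 \<le> 1 / real n * ln (growth x n)"
      using growth_periodic(1)[where x = x, OF assms] by simp
    show "\<forall>n. 1 / real n * ln (growth x n) \<le> 1 / real n * ln (2 ^ (5 * m))"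
    proof
      fix n
      have "0 < growth x n" using growth_periodic(1)[where x = x, OF assms, of n] by linarith
      then have "ln (growth x n) \<le> ln (2 ^ (5 * m))"
        using growth_periodic(2)[where x = x, OF assms, of n] by (subst ln_le_cancel_iff) auto
      then show "1 / real n * ln (growth x n) \<le> 1 / real n * ln (2 ^ (5 * m))"
        by (intro mult_left_mono) auto
    qed
    show "(\<lambda>n. 1 / real n * ln (2 ^ (5 * m))) \<longlonglongrightarrow> 0"
      by (rule tendsto_mult_left_zero[OF lim_1_over_n])
  qed simp
  then show ?thesis by (simp add: zero_ereal_def)
qed

lemma exponent_periodic:
  assumes "periodic_point p"
  shows "lyapunov_exponent WV generator (orbit_measure p) = 0"
proof -
  obtain m where m: "m > 0" "(shift ^^ m) p = p"
    using assms by (auto simp: periodic_point_def)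
  have per: "p (k + int m) = p k" for k
    using fun_cong[OF m(2), of k] by (simp add: shift_iterate)
  define R where "R = range (\<lambda>n. (shift ^^ n) p)"
  \<comment> \<open>Finiteness of the orbit is what makes its uniform counting measure a
    probability.\<close>
  have "R = (\<lambda>n. (shift ^^ n) p) ` {..<m}"
  proof
    show "R \<subseteq> (\<lambda>n. (shift ^^ n) p) ` {..<m}"
    proof
      fix x assume "x \<in> R"
      then obtain n where "x = (shift ^^ n) p" by (auto simp: R_def)
      then have "x = (shift ^^ (n mod m)) p" by (simp add: funpow_mod_eq[OF m(2)])
      then show "x \<in> (\<lambda>n. (shift ^^ n) p) ` {..<m}" using m(1) by simp
    qed
  qed (auto simp: R_def)
  then have fin: "finite R" by simp
  have "R \<noteq> {}" by (simp add: R_def)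
  interpret R: prob_space "uniform_count_measure R"
    by (rule prob_space_uniform_count_measure) fact+
  have id: "(\<lambda>x. x) \<in> measurable (uniform_count_measure R) borel"
    by (auto simp: measurable_def space_uniform_count_measure sets_uniform_count_measure)
  \<comment> \<open>Makes periodicity a Borel event, so that it passes from the orbit to the image
    measure on the shift space.\<close>
  have "open {x :: full_shift. x i = x j}" for i j
  proof -
    have "{x :: full_shift. x i = x j} =
        ({x. x i = True} \<inter> {x. x j = True}) \<union> ({x. x i = False} \<inter> {x. x j = False})"
      by auto
    then show ?thesis by (simp only: open_Un open_Int open_coordinate)
  qed
  then have "{x \<in> space (borel :: full_shift measure). x (k + int m) = x k} \<in> sets borel" for k
    by (simp add: borel_open)
  then have meas: "{x \<in> space (borel :: full_shift measure). \<forall>k. x (k + int m) = x k} \<in> sets borel"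
    by (rule sets.sets_Collect_countable_All)
  have R_per: "x (k + int m) = x k" if "x \<in> R" for x k
  proof -
    obtain n where "x = (shift ^^ n) p" using \<open>x \<in> R\<close> by (auto simp: R_def)
    then show ?thesis using per[of "k + int n"] by (simp add: shift_iterate add_ac)
  qed
  have "AE x in orbit_measure p. \<forall>k. x (k + int m) = x k"
    unfolding orbit_measure_def R_def[symmetric] AE_distr_iff[OF id meas]
    by (rule AE_I2) (simp add: R_per space_uniform_count_measure)
  then have "AE x in orbit_measure p. (\<lambda>n. ereal (1 / real n * ln (growth x n))) \<longlonglongrightarrow> 0"
    by eventually_elim (blast intro: exponent_periodic_point[OF m(1)])
  moreover have "prob_space (orbit_measure p)"
    unfolding orbit_measure_def R_def[symmetric] by (rule R.prob_space_distr[OF id])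
  ultimately show ?thesis by (intro lyapunov_exponent_eqI)
qed

theorem proposition1p5:
  shows "\<exists>(V :: (nat \<Rightarrow> real) normed_space) (A :: full_shift \<Rightarrow> (nat \<Rightarrow> real) \<Rightarrow> (nat \<Rightarrow> real))
            (\<mu> :: full_shift measure).
           banach_space V \<and>
           A \<in> UNIV \<rightarrow> carrier (GL V) \<and> locally_constant A \<and>
           ergodic_invariant_prob \<mu> \<and>
           lyapunov_exponent V A \<mu> >
             (SUP p\<in>{p. periodic_point p}. lyapunov_exponent V A (orbit_measure p))"
proof (intro exI conjI)
  show "banach_space WV" by (rule WV.banach_space_weighted)
  show "generator \<in> UNIV \<rightarrow> carrier (GL WV)" by (simp add: generator_in_GL)
  show "locally_constant generator" by (rule locally_constant_generator)
  show "ergodic_invariant_prob toeplitz_measure" by (rule ergodic_toeplitz)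
  have "(SUP p\<in>{p. periodic_point p}. lyapunov_exponent WV generator (orbit_measure p)) \<le> 0"
    by (intro SUP_least) (simp add: exponent_periodic)
  also have "0 < lyapunov_exponent WV generator toeplitz_measure"
    by (simp add: exponent_toeplitz)
  finally show "(SUP p\<in>{p. periodic_point p}. lyapunov_exponent WV generator (orbit_measure p))
      < lyapunov_exponent WV generator toeplitz_measure" .
qed

end
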